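(* For every finite poset $P$, the subprobabilistic powerdomain $\mathcal V_{\leq 1}(P)$ is a countably based FS-domain.
   Context: A dcpo is a poset in which every (nonempty) directed subset has a supremum. Scott-continuous maps are monotone maps preserving directed suprema. $a\ll b$ means: whenever $b\leq\sup E$ with $E$ directed, some $e\in E$ has $a\leq e$. A dcpo $D$ is countably based if it has a countable subset $B$ such that for each $x\in D$ the set $\{b\in B:b\ll x\}$ is directed with supremum $x$. A Scott-continuous $f:D\to D$ is finitely separated from the identity if there is a finite $M\subseteq D$ such that for every $x\in D$ some $m\in M$ satisfies $f(x)\leq m\leq x$. $D$ is an FS-domain if there is a pointwise-directed family of Scott-continuous self-maps, each finitely separated from the identity, with pointwise supremum $\mathrm{id}_D$. For a finite poset $P$, $\mathcal V_{\leq 1}(P)$ is the dcpo of subprobabilistic valuations on $P$, i.e. monotone maps $\nu$ from the lattice of upper sets of $P$ to $[0,1]$ with $\nu(\varnothing)=0$ and $\nu(U)+\nu(V)=\nu(U\cup V)+\nu(U\cap V)$, ordered pointwise. Equivalently, it is the set $\{p\in\mathbb R_{\geq 0}^P:\sum_{x\in P}p_x\leq 1\}$ with $p\leq_{\mathrm{st}}q$ iff $\sum_{x\in U}p_x\leq\sum_{x\in U}q_x$ for every upper set $U\subseteq P$. *)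

theory Defs
  imports Complex_Main "HOL-Algebra.Order" "HOL-Library.Countable_Set"
begin

section \<open>Dcpos, countable bases and FS-domains\<close>

definition directed_in :: "('a, 'b) gorder_scheme \<Rightarrow> 'a set \<Rightarrow> bool" where
  "directed_in L E \<longleftrightarrow>
     E \<subseteq> carrier L \<and> E \<noteq> {} \<and> (\<forall>x\<in>E. \<forall>y\<in>E. \<exists>z\<in>E. x \<sqsubseteq>\<^bsub>L\<^esub> z \<and> y \<sqsubseteq>\<^bsub>L\<^esub> z)"

definition dcpo :: "('a, 'b) gorder_scheme \<Rightarrow> bool" where
  "dcpo L \<longleftrightarrow> partial_order L \<and> (\<forall>E. directed_in L E \<longrightarrow> (\<exists>s. is_lub L s E))"

definition scott_continuous ::
  "('a, 'c) gorder_scheme \<Rightarrow> ('b, 'd) gorder_scheme \<Rightarrow> ('a \<Rightarrow> 'b) \<Rightarrow> bool" where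
  "scott_continuous A B f \<longleftrightarrow>
     f \<in> carrier A \<rightarrow> carrier B \<and> isotone A B f \<and>
     (\<forall>E s. directed_in A E \<and> is_lub A s E \<longrightarrow> is_lub B (f s) (f ` E))"

definition way_below :: "('a, 'b) gorder_scheme \<Rightarrow> 'a \<Rightarrow> 'a \<Rightarrow> bool" where
  "way_below L a b \<longleftrightarrow>
     (\<forall>E s. directed_in L E \<and> is_lub L s E \<and> b \<sqsubseteq>\<^bsub>L\<^esub> s \<longrightarrow> (\<exists>e\<in>E. a \<sqsubseteq>\<^bsub>L\<^esub> e))"

definition countably_based :: "('a, 'b) gorder_scheme \<Rightarrow> bool" where
  "countably_based L \<longleftrightarrow>
     dcpo L \<and>
     (\<exists>B. countable B \<and> B \<subseteq> carrier L \<and>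
        (\<forall>x\<in>carrier L. directed_in L {b\<in>B. way_below L b x} \<and>
                        is_lub L x {b\<in>B. way_below L b x}))"

definition finitely_separated :: "('a, 'b) gorder_scheme \<Rightarrow> ('a \<Rightarrow> 'a) \<Rightarrow> bool" where
  "finitely_separated L f \<longleftrightarrow>
     (\<exists>M. finite M \<and> M \<subseteq> carrier L \<and>
        (\<forall>x\<in>carrier L. \<exists>m\<in>M. f x \<sqsubseteq>\<^bsub>L\<^esub> m \<and> m \<sqsubseteq>\<^bsub>L\<^esub> x))"

definition pointwise_directed :: "('a, 'b) gorder_scheme \<Rightarrow> ('a \<Rightarrow> 'a) set \<Rightarrow> bool" where
  "pointwise_directed L F \<longleftrightarrow>
     F \<noteq> {} \<and>
     (\<forall>f\<in>F. \<forall>g\<in>F. \<exists>h\<in>F. \<forall>x\<in>carrier L. f x \<sqsubseteq>\<^bsub>L\<^esub> h x \<and> g x \<sqsubseteq>\<^bsub>L\<^esub> h x)"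

definition FS_domain :: "('a, 'b) gorder_scheme \<Rightarrow> bool" where
  "FS_domain L \<longleftrightarrow>
     dcpo L \<and>
     (\<exists>F. pointwise_directed L F \<and>
        (\<forall>f\<in>F. scott_continuous L L f \<and> finitely_separated L f) \<and>
        (\<forall>x\<in>carrier L. is_lub L x ((\<lambda>f. f x) ` F)))"


section \<open>The subprobabilistic powerdomain of a poset\<close>

definition upper_sets :: "('a, 'b) gorder_scheme \<Rightarrow> 'a set set" where
  "upper_sets P =
     {U. U \<subseteq> carrier P \<and> (\<forall>x\<in>U. \<forall>y\<in>carrier P. x \<sqsubseteq>\<^bsub>P\<^esub> y \<longrightarrow> y \<in> U)}"

text \<open>
  The extensional function space \<open>\<rightarrow>\<^sub>E\<close> makes a valuation determined by its values
  on upper sets, so that the pointwise order is antisymmetric with respect to equality.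
  For a finite poset every upper set is open in the Scott topology and directed families of
  upper sets are finite, so no separate continuity condition on valuations is needed.
\<close>

definition subprob_valuations :: "('a, 'b) gorder_scheme \<Rightarrow> ('a set \<Rightarrow> real) set" where
  "subprob_valuations P =
     {\<nu> \<in> upper_sets P \<rightarrow>\<^sub>E {0..1}.
        mono_on (upper_sets P) \<nu> \<and> \<nu> {} = 0 \<and>
        (\<forall>U\<in>upper_sets P. \<forall>V\<in>upper_sets P. \<nu> U + \<nu> V = \<nu> (U \<union> V) + \<nu> (U \<inter> V))}"

definition subprob_powerdomain :: "('a, 'b) gorder_scheme \<Rightarrow> ('a set \<Rightarrow> real) gorder" where
  "subprob_powerdomain P =
     \<lparr> carrier = subprob_valuations P,
       eq = (=),
       le = (\<lambda>\<mu> \<nu>. \<forall>U\<in>upper_sets P. \<mu> U \<le> \<nu> U) \<rparr>"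

end

theory Submission
  imports Defs
begin

text \<open>
  Fix \<open>\<delta> > 0\<close> and call an upper set \<open>V\<close> light for a valuation \<open>p\<close> if
  \<open>p V \<le> \<delta> * N ^ card V\<close>, where \<open>N = 2 |P| + 2\<close>. There is a largest light set \<open>W\<close>, it shrinks as
  \<open>p\<close> grows, and it is eventually constant along a directed set. Trimming \<open>p\<close> deletes the mass
  on \<open>W\<close> and subtracts \<open>2 * \<delta> * N ^ card W - p W > 0\<close> from each maximal point outside \<open>W\<close>; these points
  carry enough mass because \<open>W\<close> is the largest light set. For constant \<open>W\<close> the result is affine
  and monotone in \<open>p\<close>, and a drop of \<open>W\<close> reduces the loss by a factor \<open>N\<close>, so trimming is
  Scott-continuous. It lowers the value at every upper set \<open>U\<close> to at most
  \<open>max 0 (p U - \<delta>)\<close> while losing at most \<open>\<delta> * N ^ (|P| + 1)\<close>. Hence the trimmed \<open>p\<close> lies below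
  every valuation \<open>\<delta>\<close>-close to \<open>p\<close>, and trimming twice is separated from the identity by
  the trimmed points of a finite \<open>\<delta>/2\<close>-net. These points, for all \<open>\<delta> = 1/n\<close>, form
  a countable basis.
\<close>

section \<open>A criterion for countably based FS-domains\<close>

lemma way_below_imp_le:
  assumes "partial_order L" "way_below L a x" "a \<in> carrier L" "x \<in> carrier L"
  shows "a \<sqsubseteq>\<^bsub>L\<^esub> x"
proof -
  interpret partial_order L by fact
  have "directed_in L {x}" and "is_lub L x {x}"
    using assms(4) by (auto simp: directed_in_def least_def Upper_def)
  then show ?thesis
    using assms(2,4) unfolding way_below_def by blast
qed

text \<open>Separation is asked for with \<open>way_below L m x\<close> in place of
  \<open>m \<sqsubseteq> x\<close>, so that the finite separating sets also supply a basis: their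
  union is countable, and below each \<open>x\<close> its members interleave with the directed
  family \<open>f n x\<close>.\<close>

lemma countably_based_FS_domainI:
  fixes L (structure) and f :: "nat \<Rightarrow> 'a \<Rightarrow> 'a"
  assumes dcpo: "dcpo L"
    and cont: "\<And>n. scott_continuous L L (f n)"
    and dir: "\<And>m n. \<exists>k. \<forall>x\<in>carrier L. f m x \<sqsubseteq>\<^bsub>L\<^esub> f k x \<and> f n x \<sqsubseteq>\<^bsub>L\<^esub> f k x"
    and lub: "\<And>x. x \<in> carrier L \<Longrightarrow> is_lub L x (range (\<lambda>n. f n x))"
    and sep: "\<And>n. \<exists>M. finite M \<and> M \<subseteq> carrier L \<and>
                 (\<forall>x\<in>carrier L. \<exists>m\<in>M. f n x \<sqsubseteq>\<^bsub>L\<^esub> m \<and> way_below L m x)"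
  shows "countably_based L \<and> FS_domain L"
proof -
  have po: "partial_order L"
    using dcpo by (simp add: dcpo_def)
  interpret partial_order L by (fact po)
  obtain M where fin: "\<And>n. finite (M n)" and M: "\<And>n. M n \<subseteq> carrier L"
    and Msep: "\<And>n x. x \<in> carrier L \<Longrightarrow> \<exists>m\<in>M n. f n x \<sqsubseteq> m \<and> way_below L m x"
    using sep by metis
  have fcl: "f n x \<in> carrier L" if "x \<in> carrier L" for n x
    using cont[of n] that unfolding scott_continuous_def by blast
  have range_cl: "range (\<lambda>n. f n x) \<subseteq> carrier L" if "x \<in> carrier L" for x
    using fcl that by auto
  have range_dir: "directed_in L (range (\<lambda>n. f n x))" if "x \<in> carrier L" for x
    unfolding directed_in_def using dir that range_cl[OF that] by blast
  define B where "B = (\<Union>n. M n)"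
  have B: "countable B" "B \<subseteq> carrier L"
    unfolding B_def using M by (auto intro: countable_finite fin)
  have "directed_in L {b\<in>B. way_below L b x} \<and> is_lub L x {b\<in>B. way_below L b x}"
    (is "directed_in L ?D \<and> _") if x: "x \<in> carrier L" for x
  proof
    have D: "?D \<subseteq> carrier L"
      using B by auto
    \<comment> \<open>The two facts \<open>above_f\<close> and \<open>below_f\<close> make
      \<open>?D\<close> and the family \<open>f n x\<close> mutually cofinal; the second applies
      \<open>b\<close> way below \<open>x\<close> to this family, whose supremum is
      \<open>x\<close>. Directedness and supremum then pass from the family to
      \<open>?D\<close>.\<close>
    have above_f: "\<exists>b\<in>?D. f n x \<sqsubseteq> b" for n
      using Msep[OF x, of n] unfolding B_def by blast
    have below_f: "\<exists>n. b \<sqsubseteq> f n x" if "b \<in> ?D" for b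
      using that range_dir[OF x] lub[OF x] x unfolding way_below_def by blast
    have "\<exists>c\<in>?D. a \<sqsubseteq> c \<and> b \<sqsubseteq> c" if ab: "a \<in> ?D" "b \<in> ?D" for a b
    proof -
      obtain m n where mn: "a \<sqsubseteq> f m x" "b \<sqsubseteq> f n x"
        using below_f ab by blast
      obtain k where k: "f m x \<sqsubseteq> f k x" "f n x \<sqsubseteq> f k x"
        using dir x by blast
      obtain c where c: "c \<in> ?D" "f k x \<sqsubseteq> c"
        using above_f by blast
      have "a \<sqsubseteq> c" "b \<sqsubseteq> c"
        using mn k c ab D fcl[OF x] by (meson le_trans subsetD)+
      then show ?thesis using c by blast
    qed
    moreover have "?D \<noteq> {}"
      using above_f by blast
    ultimately show "directed_in L ?D"
      using D unfolding directed_in_def by blast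
    show "is_lub L x ?D"
    proof (rule least_UpperI)
      show "b \<sqsubseteq> x" if "b \<in> ?D" for b
        using that D x by (intro way_below_imp_le[OF po]) auto
      show "x \<sqsubseteq> y" if y: "y \<in> Upper L ?D" for y
      proof -
        have ycl: "y \<in> carrier L" using y by (simp add: Upper_def)
        have "f n x \<sqsubseteq> y" for n
        proof -
          obtain b where b: "b \<in> ?D" "f n x \<sqsubseteq> b" using above_f by blast
          moreover have "b \<sqsubseteq> y" using y b D by (auto simp: Upper_def)
          ultimately show ?thesis using D fcl[OF x] ycl by (meson le_trans subsetD)
        qed
        then have "y \<in> Upper L (range (\<lambda>n. f n x))"
          using ycl by (auto simp: Upper_def)
        then show ?thesis using lub[OF x] by (simp add: least_def)
      qed
    qed (use D x in auto)
  qed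
  then have "countably_based L"
    unfolding countably_based_def using dcpo B by blast
  moreover have "finitely_separated L (f n)" for n
    unfolding finitely_separated_def
    using fin M Msep way_below_imp_le[OF po] by (meson subsetD)
  then have "FS_domain L"
    unfolding FS_domain_def pointwise_directed_def
    using dcpo cont dir lub by (intro conjI exI[of _ "range f"]) (auto simp: image_image)
  ultimately show ?thesis ..
qed


section \<open>Valuations on a finite poset\<close>

locale finite_poset = partial_order P for P (structure) +
  assumes finite_carrier: "finite (carrier P)"
begin

abbreviation "K \<equiv> subprob_powerdomain P"
abbreviation "\<U> \<equiv> upper_sets P"

lemma finite_upper_sets: "finite \<U>"
  by (rule finite_subset[of _ "Pow (carrier P)"]) (auto simp: upper_sets_def finite_carrier)

lemma upper_set_finite: "U \<in> \<U> \<Longrightarrow> finite U"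
  using finite_carrier finite_subset by (auto simp: upper_sets_def)

lemma upper_set_Un: "U \<in> \<U> \<Longrightarrow> V \<in> \<U> \<Longrightarrow> U \<union> V \<in> \<U>"
  and upper_set_Int: "U \<in> \<U> \<Longrightarrow> V \<in> \<U> \<Longrightarrow> U \<inter> V \<in> \<U>"
  and upper_set_empty: "{} \<in> \<U>"
  by (auto simp: upper_sets_def)

lemma card_upper_set_le: "U \<in> \<U> \<Longrightarrow> card U \<le> card (carrier P)"
  using finite_carrier by (auto simp: upper_sets_def intro: card_mono)

lemma in_carrier_iff:
  "p \<in> carrier K \<longleftrightarrow>
     p \<in> extensional \<U> \<and> (\<forall>U\<in>\<U>. 0 \<le> p U \<and> p U \<le> 1) \<and>
     (\<forall>U\<in>\<U>. \<forall>V\<in>\<U>. U \<subseteq> V \<longrightarrow> p U \<le> p V) \<and> p {} = 0 \<and>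
     (\<forall>U\<in>\<U>. \<forall>V\<in>\<U>. p U + p V = p (U \<union> V) + p (U \<inter> V))"
  by (auto simp: subprob_powerdomain_def subprob_valuations_def PiE_def mono_on_def)

lemma val_nonneg: "p \<in> carrier K \<Longrightarrow> U \<in> \<U> \<Longrightarrow> 0 \<le> p U"
  and val_le_one: "p \<in> carrier K \<Longrightarrow> U \<in> \<U> \<Longrightarrow> p U \<le> 1"
  and val_mono: "p \<in> carrier K \<Longrightarrow> U \<in> \<U> \<Longrightarrow> V \<in> \<U> \<Longrightarrow> U \<subseteq> V \<Longrightarrow> p U \<le> p V"
  and val_empty: "p \<in> carrier K \<Longrightarrow> p {} = 0"
  and val_modular: "p \<in> carrier K \<Longrightarrow> U \<in> \<U> \<Longrightarrow> V \<in> \<U> \<Longrightarrow> p U + p V = p (U \<union> V) + p (U \<inter> V)"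
  by (simp_all add: in_carrier_iff)

lemma le_iff: "p \<sqsubseteq>\<^bsub>K\<^esub> q \<longleftrightarrow> (\<forall>U\<in>\<U>. p U \<le> q U)"
  by (simp add: subprob_powerdomain_def)

lemma partial_order_K: "partial_order K"
proof -
  have eq: "eq K = (=)"
    by (simp add: subprob_powerdomain_def)
  show ?thesis
  proof (unfold_locales, unfold eq le_iff)
    fix p q assume "\<forall>U\<in>\<U>. p U \<le> q U" "\<forall>U\<in>\<U>. q U \<le> p U" "p \<in> carrier K" "q \<in> carrier K"
    then show "p = q"
      by (intro extensionalityI[of _ \<U>]) (auto simp: in_carrier_iff intro: antisym)
  qed (auto intro: order_trans)
qed

sublocale K: partial_order K
  by (rule partial_order_K)

section \<open>Directed suprema of valuations\<close>

text \<open>The supremum is taken pointwise. As there are only finitely many upper sets,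
  directedness gives one member of \<open>E\<close> that is \<open>\<eta>\<close>-close to it on all
  of them at once; this uniform approximation carries modularity to the limit and later drives the
  continuity and way-below arguments.\<close>

lemma directed_lub:
  assumes E: "directed_in K E"
  shows "\<exists>s. is_lub K s E \<and> (\<forall>\<eta>>0. \<exists>e\<in>E. \<forall>U\<in>\<U>. s U - \<eta> < e U)"
proof -
  have EK: "E \<subseteq> carrier K" and ne: "E \<noteq> {}"
    and dir: "\<And>a b. a \<in> E \<Longrightarrow> b \<in> E \<Longrightarrow> \<exists>c\<in>E. a \<sqsubseteq>\<^bsub>K\<^esub> c \<and> b \<sqsubseteq>\<^bsub>K\<^esub> c"
    using E by (auto simp: directed_in_def)
  define s where "s = restrict (\<lambda>U. SUP e\<in>E. e U) \<U>"
  have bdd: "bdd_above ((\<lambda>e. e U) ` E)" if "U \<in> \<U>" for U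
    using EK that by (intro bdd_aboveI2[of _ _ 1]) (auto intro: val_le_one)
  have upper: "e U \<le> s U" if "e \<in> E" "U \<in> \<U>" for e U
    unfolding s_def using that cSUP_upper[OF that(1) bdd[OF that(2)]] by simp
  have least: "s U \<le> y" if "U \<in> \<U>" "\<And>e. e \<in> E \<Longrightarrow> e U \<le> y" for U y
    unfolding s_def using that ne by (simp add: cSUP_least)
  have approx_finite: "\<exists>e\<in>E. \<forall>U\<in>F. s U - \<eta> < e U" if "finite F" "F \<subseteq> \<U>" "\<eta> > 0" for F \<eta>
    using that
  proof (induction F)
    case empty
    then show ?case using ne by auto
  next
    case (insert V F)
    then obtain a where a: "a \<in> E" "\<forall>U\<in>F. s U - \<eta> < a U" by auto
    have "s V - \<eta> < (SUP e\<in>E. e V)"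
      using insert.prems by (simp add: s_def)
    then obtain b where b: "b \<in> E" "s V - \<eta> < b V"
      using less_cSUP_iff[OF ne bdd, of V "s V - \<eta>"] insert.prems by auto
    obtain c where "c \<in> E" "a \<sqsubseteq>\<^bsub>K\<^esub> c" "b \<sqsubseteq>\<^bsub>K\<^esub> c"
      using dir a b by blast
    then show ?case
      using a b insert.prems unfolding le_iff
      by (intro bexI[of _ c]) (auto, meson less_le_trans subsetD)
  qed
  have approx: "\<exists>e\<in>E. \<forall>U\<in>\<U>. s U - \<eta> < e U" if "\<eta> > 0" for \<eta>
    using approx_finite[OF finite_upper_sets _ that] by simp
  have s: "s \<in> carrier K"
    unfolding in_carrier_iff
  proof (intro conjI ballI impI)
    show "s \<in> extensional \<U>" by (simp add: s_def)
    fix U assume U: "U \<in> \<U>"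
    obtain e where e: "e \<in> E" using ne by auto
    then show "0 \<le> s U"
      using upper[OF e U] val_nonneg[of e U] U EK by auto
    show "s U \<le> 1"
      using EK U by (intro least) (auto intro: val_le_one)
    fix V assume V: "V \<in> \<U>"
    {
      assume "U \<subseteq> V"
      then show "s U \<le> s V"
        using EK U V by (intro least) (auto intro: order_trans[OF val_mono upper])
    }
    note [simp] = U V upper_set_Un upper_set_Int
    \<comment> \<open>Each side of the modular law for \<open>s\<close> exceeds the same side for
      \<open>e\<close> by an amount between 0 and twice \<open>\<epsilon> / 2\<close>, and for
      \<open>e\<close> the two sides agree.\<close>
    have "\<bar>s U + s V - (s (U \<union> V) + s (U \<inter> V))\<bar> \<le> 0 + \<epsilon>" if "\<epsilon> > 0" for \<epsilon>
    proof -
      obtain e where e: "e \<in> E" "\<And>U. U \<in> \<U> \<Longrightarrow> s U - \<epsilon> / 2 < e U"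
        using approx[of "\<epsilon> / 2"] \<open>\<epsilon> > 0\<close> by auto
      have "e U + e V = e (U \<union> V) + e (U \<inter> V)"
        using e EK by (intro val_modular) auto
      then show ?thesis
        using e(2)[of U] e(2)[of V] e(2)[of "U \<union> V"] e(2)[of "U \<inter> V"]
          upper[OF e(1), of U] upper[OF e(1), of V] upper[OF e(1), of "U \<union> V"]
          upper[OF e(1), of "U \<inter> V"]
        by (simp add: abs_le_iff)
    qed
    then have "\<bar>s U + s V - (s (U \<union> V) + s (U \<inter> V))\<bar> \<le> 0"
      by (rule field_le_epsilon)
    then show "s U + s V = s (U \<union> V) + s (U \<inter> V)" by simp
  next
    show "s {} = 0"
      using EK least[OF upper_set_empty, of 0] ne upper[OF _ upper_set_empty]
      by (metis all_not_in_conv order_antisym order_refl subsetD val_empty)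
  qed
  have "is_lub K s E"
  proof (rule least_UpperI)
    show "e \<sqsubseteq>\<^bsub>K\<^esub> s" if "e \<in> E" for e
      using that upper by (simp add: le_iff)
    show "s \<sqsubseteq>\<^bsub>K\<^esub> y" if "y \<in> Upper K E" for y
      using that EK unfolding le_iff by (auto intro!: least simp: Upper_def le_iff)
  qed (use EK s in auto)
  then show ?thesis using approx by blast
qed

lemma dcpo_K: "dcpo K"
  unfolding dcpo_def using partial_order_K directed_lub by blast

lemma directed_approx:
  assumes "directed_in K E" "is_lub K s E" "\<eta> > 0"
  shows "\<exists>e\<in>E. \<forall>U\<in>\<U>. s U - \<eta> < e U"
  using directed_lub[OF assms(1)] assms(2,3) K.least_unique by metis


section \<open>Trimming off light upper sets\<close>

text \<open>The value is at least 2, so that two thresholds add up to at most the next one, and at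
  least \<open>2 * card (carrier P) + 1\<close>, so that one threshold lost on \<open>W\<close> and
  two at every top-layer point also stay within the next one.\<close>

definition base :: real where
  "base = 2 * real (card (carrier P)) + 2"

definition light :: "real \<Rightarrow> ('a set \<Rightarrow> real) \<Rightarrow> 'a set set" where
  "light \<delta> p = {V \<in> \<U>. p V \<le> \<delta> * base ^ card V}"

definition light_part :: "real \<Rightarrow> ('a set \<Rightarrow> real) \<Rightarrow> 'a set" where
  "light_part \<delta> p = \<Union>(light \<delta> p)"

definition top_layer :: "'a set \<Rightarrow> 'a set" where
  "top_layer W = {s \<in> carrier P - W. \<forall>y\<in>carrier P - W. s \<sqsubseteq> y \<longrightarrow> y = s}"

text \<open>
  In terms of point masses: the mass on \<open>W\<close> is deleted, and the mass of every point in the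
  top layer below \<open>W\<close> is changed by \<open>p W - 2 * \<delta> * base ^ card W\<close>, which is negative.
\<close>

definition trim_at :: "real \<Rightarrow> 'a set \<Rightarrow> ('a set \<Rightarrow> real) \<Rightarrow> 'a set \<Rightarrow> real" where
  "trim_at \<delta> W p U =
     p (U \<union> W) - p W + real (card (top_layer W \<inter> U)) * (p W - 2 * \<delta> * base ^ card W)"

definition trim :: "real \<Rightarrow> ('a set \<Rightarrow> real) \<Rightarrow> 'a set \<Rightarrow> real" where
  "trim \<delta> p = restrict (trim_at \<delta> (light_part \<delta> p) p) \<U>"

section \<open>Light sets and the layer below them\<close>

lemma base_ge_2: "2 \<le> base"
  by (simp add: base_def)

lemma base_power_mono: "i \<le> j \<Longrightarrow> base ^ i \<le> base ^ j"
  using base_ge_2 by (intro power_increasing) auto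

lemma base_power_ge_1: "1 \<le> base ^ i"
  using base_ge_2 by (intro one_le_power) auto

lemma top_layer_card: "card (top_layer W \<inter> U) \<le> card (carrier P)"
  using finite_carrier by (intro card_mono) (auto simp: top_layer_def)

lemma finite_top_layer: "finite (top_layer W)"
  using finite_carrier by (auto simp: top_layer_def)

text \<open>By maximality, everything strictly above \<open>s\<close> already lies in
  \<open>W\<close>.\<close>

lemma insert_top_layer:
  assumes "W \<in> \<U>" "s \<in> top_layer W"
  shows "insert s W \<in> \<U>"
  using assms by (auto simp: upper_sets_def top_layer_def)

text \<open>A maximal element of the finite set \<open>U - W\<close> is maximal in the whole
  complement of \<open>W\<close>, because \<open>U\<close> is an upper set.\<close>

lemma top_layer_meets:
  assumes W: "W \<in> \<U>" and U: "U \<in> \<U>" and "\<not> U \<subseteq> W"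
  shows "top_layer W \<inter> U \<noteq> {}"
proof -
  let ?R = "\<lambda>x y. x \<sqsubseteq> y \<and> x \<noteq> y"
  have sub: "U - W \<subseteq> carrier P" using U by (auto simp: upper_sets_def)
  have "asymp_on (U - W) ?R"
    using sub by (auto simp: asymp_on_def intro: le_antisym)
  moreover have "transp_on (U - W) ?R"
  proof (rule transp_onI)
    fix x y z
    assume "x \<in> U - W" "y \<in> U - W" "z \<in> U - W" and *: "?R x y" "?R y z"
    then have cl: "x \<in> carrier P" "y \<in> carrier P" "z \<in> carrier P"
      using sub by auto
    then show "?R x z"
      using * le_trans[of x y z] le_antisym[of x y] by auto
  qed
  ultimately obtain s where s: "s \<in> U - W" "\<forall>x\<in>U - W. x \<noteq> s \<longrightarrow> \<not> ?R s x"
    using Finite_Set.bex_max_element[of "U - W" ?R] upper_set_finite[OF U] assms(3) by auto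
  have "s \<in> top_layer W"
    unfolding top_layer_def
  proof (intro CollectI conjI ballI impI)
    show "s \<in> carrier P - W" using s sub by auto
    fix y assume y: "y \<in> carrier P - W" "s \<sqsubseteq> y"
    then have "y \<in> U - W" using s U by (auto simp: upper_sets_def)
    then show "y = s" using s y by blast
  qed
  then show ?thesis using s by auto
qed

text \<open>Geometric growth of the thresholds makes light sets closed under unions.\<close>

lemma light_Un:
  assumes p: "p \<in> carrier K" and "\<delta> > 0" and U: "U \<in> light \<delta> p" and V: "V \<in> light \<delta> p"
  shows "U \<union> V \<in> light \<delta> p"
proof (cases "U \<subseteq> V \<or> V \<subseteq> U")
  case True
  then show ?thesis using U V by (auto simp: sup_absorb1 sup_absorb2)
next
  case False
  have UV: "U \<in> \<U>" "V \<in> \<U>" using U V by (auto simp: light_def)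
  then have fin: "finite (U \<union> V)" using upper_set_finite by auto
  \<comment> \<open>Incomparable sets are both proper subsets of their union, so both thresholds lie
    at least one power of \<open>base\<close> below that of the union.\<close>
  have less: "card U < card (U \<union> V)" "card V < card (U \<union> V)"
    using False by (auto intro!: psubset_card_mono[OF fin])
  then obtain k where k: "card (U \<union> V) = Suc k" "card U \<le> k" "card V \<le> k"
    by (cases "card (U \<union> V)") auto
  have "p (U \<union> V) \<le> p U + p V"
    using val_modular[OF p UV] val_nonneg[OF p upper_set_Int[OF UV]] by simp
  also have "\<dots> \<le> \<delta> * base ^ card U + \<delta> * base ^ card V"
    using U V by (intro add_mono) (auto simp: light_def)
  also have "\<dots> \<le> \<delta> * base ^ k + \<delta> * base ^ k"
    using k \<open>\<delta> > 0\<close> by (intro add_mono mult_left_mono base_power_mono) auto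
  also have "\<dots> = \<delta> * (2 * base ^ k)" by simp
  also have "\<dots> \<le> \<delta> * base ^ Suc k"
    using base_ge_2 \<open>\<delta> > 0\<close> by (intro mult_left_mono) (auto intro: mult_right_mono)
  finally show ?thesis
    using k UV upper_set_Un by (simp add: light_def)
qed

text \<open>Only finitely many sets are light, and binary unions of light sets are light; the
  induction starts at \<open>{}\<close>, which carries no mass. Hence \<open>light_part\<close> is
  the largest light set.\<close>

lemma light_part_light:
  assumes p: "p \<in> carrier K" and "\<delta> > 0"
  shows "light_part \<delta> p \<in> light \<delta> p"
proof -
  have "\<Union>F \<in> light \<delta> p" if "finite F" "F \<subseteq> light \<delta> p" for F
    using that
  proof (induction F)
    case empty
    then show ?case
      using val_empty[OF p] upper_set_empty \<open>\<delta> > 0\<close> by (simp add: light_def)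
  next
    case (insert V F)
    then show ?case using light_Un[OF p \<open>\<delta> > 0\<close>] by auto
  qed
  moreover have "finite (light \<delta> p)"
    using finite_upper_sets by (simp add: light_def)
  ultimately show ?thesis
    by (simp add: light_part_def)
qed

lemma light_part_upper: "p \<in> carrier K \<Longrightarrow> \<delta> > 0 \<Longrightarrow> light_part \<delta> p \<in> \<U>"
  using light_part_light by (auto simp: light_def)

lemma light_part_le:
  "p \<in> carrier K \<Longrightarrow> \<delta> > 0 \<Longrightarrow> p (light_part \<delta> p) \<le> \<delta> * base ^ card (light_part \<delta> p)"
  using light_part_light by (auto simp: light_def)

lemma light_part_antimono:
  assumes "p \<sqsubseteq>\<^bsub>K\<^esub> q"
  shows "light_part \<delta> q \<subseteq> light_part \<delta> p"
  using assms unfolding light_part_def light_def le_iff by (fastforce intro: order_trans)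

text \<open>Since \<open>W\<close> is the largest light set, \<open>insert s W\<close> exceeds its
  threshold, which is \<open>base\<close> times that of \<open>W\<close>. So the point
  \<open>s\<close> carries at least the mass that trimming takes from it.\<close>

lemma insert_top_layer_heavy:
  assumes p: "p \<in> carrier K" and "\<delta> > 0" and s: "s \<in> top_layer W" and W: "W = light_part \<delta> p"
  shows "2 * \<delta> * base ^ card W \<le> p (insert s W)"
proof -
  have WU: "W \<in> \<U>" and sW: "s \<notin> W"
    using light_part_upper p \<open>\<delta> > 0\<close> W s by (auto simp: top_layer_def)
  have "insert s W \<notin> light \<delta> p"
    using sW W by (auto simp: light_part_def)
  then have "\<delta> * base ^ Suc (card W) < p (insert s W)"
    using insert_top_layer[OF WU s] sW upper_set_finite[OF WU] by (auto simp: light_def)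
  moreover have "\<delta> * (2 * base ^ card W) \<le> \<delta> * base ^ Suc (card W)"
    using base_ge_2 \<open>\<delta> > 0\<close> by (intro mult_left_mono) (auto intro: mult_right_mono)
  ultimately show ?thesis by simp
qed

text \<open>The points of \<open>T\<close> are added one at a time. The set built so far meets
  \<open>insert s W\<close> exactly in \<open>W\<close>, so modularity makes each step gain
  \<open>p (insert s W) - p W\<close>.\<close>

lemma val_add_top_layer:
  assumes p: "p \<in> carrier K" and W: "W \<in> \<U>" and A: "A \<in> \<U>" "W \<subseteq> A"
    and heavy: "\<And>s. s \<in> top_layer W \<Longrightarrow> c \<le> p (insert s W)"
    and "finite T" "T \<subseteq> top_layer W" "T \<inter> A = {}"
  shows "A \<union> T \<in> \<U> \<and> p A + real (card T) * (c - p W) \<le> p (A \<union> T)"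
  using assms(6-)
proof (induction T)
  case empty
  then show ?case using A by simp
next
  case (insert s T)
  then have IH: "A \<union> T \<in> \<U>" "p A + real (card T) * (c - p W) \<le> p (A \<union> T)"
    and s: "s \<in> top_layer W" "s \<notin> A \<union> T" by auto
  have sW: "insert s W \<in> \<U>" using insert_top_layer[OF W s(1)] .
  have eq: "(A \<union> T) \<union> insert s W = A \<union> insert s T" "(A \<union> T) \<inter> insert s W = W"
    using s A insert.prems by (auto simp: top_layer_def)
  have "p (A \<union> T) + p (insert s W) = p (A \<union> insert s T) + p W"
    using val_modular[OF p IH(1) sW] eq by simp
  moreover have "A \<union> insert s T \<in> \<U>"
    using upper_set_Un[OF IH(1) sW] eq by simp
  ultimately show ?case
    using IH heavy[OF s(1)] insert.hyps by (simp add: algebra_simps)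
qed

section \<open>Bounds on the trimmed valuation\<close>

lemma trim_below_light:
  assumes "U \<subseteq> W"
  shows "trim_at \<delta> W p U = 0"
proof -
  have "top_layer W \<inter> U = {}" using assms by (auto simp: top_layer_def)
  then show ?thesis using assms by (simp add: trim_at_def sup_absorb2)
qed

text \<open>At least one top-layer point lies in \<open>U\<close> and loses two thresholds minus
  \<open>p W\<close>; as \<open>p W\<close> is at most one threshold, one threshold remains as the
  net loss.\<close>

lemma trim_upper:
  assumes p: "p \<in> carrier K" and "\<delta> > 0" and U: "U \<in> \<U>" and W: "W = light_part \<delta> p"
    and nsub: "\<not> U \<subseteq> W"
  shows "trim_at \<delta> W p U \<le> p U - \<delta> * base ^ card W"
proof -
  have WU: "W \<in> \<U>" using light_part_upper p \<open>\<delta> > 0\<close> W by simp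
  have pW: "p W \<le> \<delta> * base ^ card W" using light_part_le p \<open>\<delta> > 0\<close> W by simp
  have "1 \<le> card (top_layer W \<inter> U)"
    using top_layer_meets[OF WU U nsub] finite_top_layer
    by (simp add: Suc_le_eq card_gt_0_iff)
  moreover have "0 \<le> 2 * \<delta> * base ^ card W - p W"
    using pW base_power_ge_1[of "card W"] \<open>\<delta> > 0\<close> val_nonneg[OF p WU] by simp
  ultimately have "1 * (2 * \<delta> * base ^ card W - p W)
      \<le> real (card (top_layer W \<inter> U)) * (2 * \<delta> * base ^ card W - p W)"
    by (intro mult_right_mono) auto
  moreover have "p (U \<union> W) - p W \<le> p U"
    using val_modular[OF p U WU] val_nonneg[OF p upper_set_Int[OF U WU]] by simp
  ultimately show ?thesis
    using pW by (simp add: trim_at_def algebra_simps)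
qed

text \<open>The loss is at most \<open>p W\<close>, which is one threshold, plus two thresholds for
  each top-layer point in \<open>U\<close>; the choice of \<open>base\<close> bounds this by the
  next threshold.\<close>

lemma trim_lower:
  assumes p: "p \<in> carrier K" and "\<delta> > 0" and U: "U \<in> \<U>" and W: "W = light_part \<delta> p"
  shows "p U - \<delta> * base ^ Suc (card W) \<le> trim_at \<delta> W p U"
proof -
  let ?n = "real (card (carrier P))" and ?c = "\<delta> * base ^ card W"
  have WU: "W \<in> \<U>" using light_part_upper p \<open>\<delta> > 0\<close> W by simp
  have pW: "p W \<le> ?c" using light_part_le p \<open>\<delta> > 0\<close> W by simp
  have "real (card (top_layer W \<inter> U)) * (2 * ?c - p W) \<le> ?n * (2 * ?c)"
    using top_layer_card val_nonneg[OF p WU] pW by (intro mult_mono) auto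
  moreover have "p U \<le> p (U \<union> W)"
    using val_mono[OF p U upper_set_Un[OF U WU]] by simp
  moreover have "\<delta> * base ^ Suc (card W) = ?n * (2 * ?c) + 2 * ?c"
    by (simp add: base_def algebra_simps)
  ultimately show ?thesis
    using pW val_nonneg[OF p WU] by (simp add: trim_at_def algebra_simps)
qed

lemma trim_le:
  assumes p: "p \<in> carrier K" and "\<delta> > 0" and U: "U \<in> \<U>"
  shows "trim \<delta> p U \<le> max 0 (p U - \<delta>)"
proof (cases "U \<subseteq> light_part \<delta> p")
  case True
  then show ?thesis using U trim_below_light by (simp add: trim_def)
next
  case False
  have "\<delta> * 1 \<le> \<delta> * base ^ card (light_part \<delta> p)"
    using base_power_ge_1 \<open>\<delta> > 0\<close> by (intro mult_left_mono) auto
  then show ?thesis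
    using trim_upper[OF p \<open>\<delta> > 0\<close> U HOL.refl False] U by (simp add: trim_def)
qed

lemma trim_ge:
  assumes p: "p \<in> carrier K" and "\<delta> > 0" and U: "U \<in> \<U>"
  shows "p U - \<delta> * base ^ Suc (card (carrier P)) \<le> trim \<delta> p U"
proof -
  have "\<delta> * base ^ Suc (card (light_part \<delta> p)) \<le> \<delta> * base ^ Suc (card (carrier P))"
    using \<open>\<delta> > 0\<close> card_upper_set_le[OF light_part_upper[OF p \<open>\<delta> > 0\<close>]]
    by (intro mult_left_mono base_power_mono) auto
  then show ?thesis
    using trim_lower[OF p \<open>\<delta> > 0\<close> U HOL.refl] U by (simp add: trim_def)
qed

text \<open>Modularity survives because both \<open>p (U \<union> W)\<close> and the number of
  top-layer points in \<open>U\<close> are modular in \<open>U\<close>. The delicate point is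
  monotonicity, where the subtracted mass must really be present.\<close>

lemma trim_closed:
  assumes p: "p \<in> carrier K" and "\<delta> > 0"
  shows "trim \<delta> p \<in> carrier K"
proof -
  define W where "W = light_part \<delta> p"
  define c where "c = 2 * \<delta> * base ^ card W"
  have WU: "W \<in> \<U>" using light_part_upper p \<open>\<delta> > 0\<close> W_def by simp
  have val: "trim \<delta> p U = p (U \<union> W) - p W + real (card (top_layer W \<inter> U)) * (p W - c)"
    if "U \<in> \<U>" for U
    using that by (simp add: trim_def trim_at_def W_def c_def)
  have mono: "trim \<delta> p U \<le> trim \<delta> p V" if U: "U \<in> \<U>" and V: "V \<in> \<U>" and "U \<subseteq> V" for U V
  proof -
    \<comment> \<open>Passing from \<open>U\<close> to \<open>V\<close> costs the subtraction at the
      points of \<open>T\<close> only, and their mass, which counts towards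
      \<open>p (V \<union> W)\<close>, pays for it.\<close>
    define T where "T = top_layer W \<inter> (V - U)"
    have T: "finite T" "T \<subseteq> top_layer W" "T \<inter> (U \<union> W) = {}"
      using finite_top_layer by (auto simp: T_def top_layer_def)
    have add: "U \<union> W \<union> T \<in> \<U> \<and> p (U \<union> W) + real (card T) * (c - p W) \<le> p (U \<union> W \<union> T)"
      using insert_top_layer_heavy[OF p \<open>\<delta> > 0\<close> _ W_def] T upper_set_Un[OF U WU]
      by (intro val_add_top_layer[OF p WU]) (auto simp: c_def)
    moreover have "p (U \<union> W \<union> T) \<le> p (V \<union> W)"
      using add upper_set_Un[OF V WU] \<open>U \<subseteq> V\<close> by (intro val_mono[OF p]) (auto simp: T_def)
    moreover have "card (top_layer W \<inter> V) = card (top_layer W \<inter> U) + card T"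
      using \<open>U \<subseteq> V\<close> finite_top_layer
      by (subst card_Un_disjoint[symmetric]) (auto simp: T_def intro: arg_cong[of _ _ card])
    ultimately show ?thesis
      using U V by (simp add: val algebra_simps)
  qed
  have emp: "trim \<delta> p {} = 0"
    using upper_set_empty by (simp add: val)
  show ?thesis
    unfolding in_carrier_iff
  proof (intro conjI ballI impI)
    show "trim \<delta> p \<in> extensional \<U>" by (simp add: trim_def)
    fix U assume U: "U \<in> \<U>"
    show "0 \<le> trim \<delta> p U"
      using mono[OF upper_set_empty U] emp by simp
    show "trim \<delta> p U \<le> 1"
      using trim_le[OF p \<open>\<delta> > 0\<close> U] val_le_one[OF p U] \<open>\<delta> > 0\<close> by simp
    fix V assume V: "V \<in> \<U>"
    show "U \<subseteq> V \<Longrightarrow> trim \<delta> p U \<le> trim \<delta> p V" by (rule mono[OF U V])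
    have "(U \<union> W) \<union> (V \<union> W) = (U \<union> V) \<union> W" "(U \<union> W) \<inter> (V \<union> W) = (U \<inter> V) \<union> W"
      by auto
    then have "p (U \<union> W) + p (V \<union> W) = p ((U \<union> V) \<union> W) + p ((U \<inter> V) \<union> W)"
      using val_modular[OF p upper_set_Un[OF U WU] upper_set_Un[OF V WU]] by metis
    moreover have "card (top_layer W \<inter> U) + card (top_layer W \<inter> V)
        = card (top_layer W \<inter> (U \<union> V)) + card (top_layer W \<inter> (U \<inter> V))"
      using card_Un_Int[of "top_layer W \<inter> U" "top_layer W \<inter> V"] finite_top_layer
      by (simp add: Int_Un_distrib Int_ac Int_Un_distrib2)
    then have "real (card (top_layer W \<inter> U)) + real (card (top_layer W \<inter> V))
        = real (card (top_layer W \<inter> (U \<union> V))) + real (card (top_layer W \<inter> (U \<inter> V)))"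
      by (metis of_nat_add)
    then have "real (card (top_layer W \<inter> U)) * (p W - c) + real (card (top_layer W \<inter> V)) * (p W - c)
        = real (card (top_layer W \<inter> (U \<union> V))) * (p W - c)
          + real (card (top_layer W \<inter> (U \<inter> V))) * (p W - c)"
      by (simp only: distrib_right[symmetric])
    ultimately show "trim \<delta> p U + trim \<delta> p V = trim \<delta> p (U \<union> V) + trim \<delta> p (U \<inter> V)"
      using U V by (simp add: val upper_set_Un upper_set_Int)
  qed (rule emp)
qed

text \<open>
  While the light part stays the same, trimming is affine in \<open>p\<close>; when it shrinks, the sets that
  are not light lose an order of magnitude less than before.
\<close>

lemma trim_mono:
  assumes p: "p \<in> carrier K" and q: "q \<in> carrier K" and "\<delta> > 0" and le: "p \<sqsubseteq>\<^bsub>K\<^esub> q"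
  shows "trim \<delta> p \<sqsubseteq>\<^bsub>K\<^esub> trim \<delta> q"
  unfolding le_iff
proof
  fix U assume U: "U \<in> \<U>"
  define W where "W = light_part \<delta> p"
  define V where "V = light_part \<delta> q"
  have WU: "W \<in> \<U>" using light_part_upper p \<open>\<delta> > 0\<close> W_def by simp
  have val: "trim \<delta> p U = trim_at \<delta> W p U" "trim \<delta> q U = trim_at \<delta> V q U"
    using U by (simp_all add: trim_def W_def V_def)
  show "trim \<delta> p U \<le> trim \<delta> q U"
  proof (cases "U \<subseteq> W")
    case True
    then have "trim \<delta> p U = 0" by (simp add: val trim_below_light)
    then show ?thesis using val_nonneg[OF trim_closed[OF q \<open>\<delta> > 0\<close>] U] by simp
  next
    case nsub: False
    show ?thesis
    proof (cases "V = W")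
      case True
      let ?m = "real (card (top_layer W \<inter> U))"
      \<comment> \<open>In \<open>trim_at\<close> the value \<open>p W\<close> has total coefficient
        \<open>?m - 1\<close>; it is nonnegative because \<open>U\<close> meets the top
        layer.\<close>
      have "card (top_layer W \<inter> U) \<noteq> 0"
        using top_layer_meets[OF WU U nsub] finite_top_layer by auto
      then have "0 \<le> (?m - 1) * (q W - p W)"
        using le WU by (intro mult_nonneg_nonneg) (auto simp: le_iff)
      moreover have "p (U \<union> W) \<le> q (U \<union> W)"
        using le upper_set_Un[OF U WU] by (simp add: le_iff)
      ultimately show ?thesis
        unfolding val True trim_at_def by (simp add: algebra_simps)
    next
      case False
      then have "V \<subset> W"
        using light_part_antimono[OF le] by (auto simp: V_def W_def)
      then have "card V < card W"
        using upper_set_finite[OF WU] by (simp add: psubset_card_mono)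
      \<comment> \<open>The left side bounds the loss of \<open>q\<close> from above, the right side
        bounds the loss of \<open>p\<close> from below.\<close>
      then have "\<delta> * base ^ Suc (card V) \<le> \<delta> * base ^ card W"
        using \<open>\<delta> > 0\<close> by (intro mult_left_mono base_power_mono) auto
      moreover have "p U \<le> q U" using le U by (simp add: le_iff)
      ultimately show ?thesis
        using trim_upper[OF p \<open>\<delta> > 0\<close> U W_def nsub] trim_lower[OF q \<open>\<delta> > 0\<close> U V_def]
        by (simp add: val)
    qed
  qed
qed

section \<open>Scott continuity of trimming\<close>

text \<open>Each of the finitely many upper sets that are not light for \<open>s\<close> exceeds its
  threshold by a positive margin. An approximation closer than the least margin makes none of them
  light.\<close>

lemma light_part_locally_constant:
  assumes s: "s \<in> carrier K"
  obtains \<eta> where "\<eta> > 0"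
    "\<And>e. e \<sqsubseteq>\<^bsub>K\<^esub> s \<Longrightarrow> \<forall>U\<in>\<U>. s U - \<eta> < e U \<Longrightarrow> light_part \<delta> e = light_part \<delta> s"
proof -
  define G where "G = (\<lambda>V. s V - \<delta> * base ^ card V) ` (\<U> - light \<delta> s)"
  \<comment> \<open>The element 1 keeps the minimum defined when every upper set is light.\<close>
  define \<eta> where "\<eta> = Min (insert 1 G)"
  have fin: "finite (insert 1 G)"
    using finite_upper_sets by (simp add: G_def)
  have "\<forall>g\<in>insert 1 G. g > 0"
    by (auto simp: G_def light_def)
  then have "\<eta> > 0"
    unfolding \<eta>_def using fin by simp
  moreover have "light_part \<delta> e = light_part \<delta> s"
    if e: "e \<sqsubseteq>\<^bsub>K\<^esub> s" "\<forall>U\<in>\<U>. s U - \<eta> < e U" for e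
  proof -
    have "V \<in> light \<delta> s" if V: "V \<in> light \<delta> e" for V
    proof (rule ccontr)
      assume "V \<notin> light \<delta> s"
      moreover have VU: "V \<in> \<U>" using V by (simp add: light_def)
      ultimately have "\<eta> \<le> s V - \<delta> * base ^ card V"
        unfolding \<eta>_def using fin by (intro Min_le) (auto simp: G_def)
      moreover have "s V - \<eta> < e V" using e VU by simp
      ultimately show False using V by (simp add: light_def)
    qed
    then show ?thesis
      using light_part_antimono[OF e(1)] unfolding light_part_def by blast
  qed
  ultimately show ?thesis using that by blast
qed

text \<open>Members of \<open>E\<close> close enough to \<open>s\<close> have the same light part as
  \<open>s\<close>, and for a fixed light part trimming is affine, so uniform approximation passes
  through it.\<close>

lemma scott_continuous_trim:
  assumes "\<delta> > 0"
  shows "scott_continuous K K (trim \<delta>)"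
  unfolding scott_continuous_def
proof (intro conjI allI impI)
  show "trim \<delta> \<in> carrier K \<rightarrow> carrier K"
    using trim_closed[OF _ assms] by auto
  show "isotone K K (trim \<delta>)"
    using trim_mono[OF _ _ assms] K.weak_partial_order_axioms by (simp add: isotone_def)
  fix E s assume "directed_in K E \<and> is_lub K s E"
  then have dir: "directed_in K E" and lub: "is_lub K s E" and EK: "E \<subseteq> carrier K"
    by (auto simp: directed_in_def)
  have s: "s \<in> carrier K" using lub by (rule least_closed)
  have le: "e \<sqsubseteq>\<^bsub>K\<^esub> s" if "e \<in> E" for e
    using least_Upper_above[OF lub that EK] .
  obtain \<eta>\<^sub>0 where \<eta>\<^sub>0: "\<eta>\<^sub>0 > 0" "\<And>e. e \<sqsubseteq>\<^bsub>K\<^esub> s \<Longrightarrow> \<forall>U\<in>\<U>. s U - \<eta>\<^sub>0 < e U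
      \<Longrightarrow> light_part \<delta> e = light_part \<delta> s"
    using light_part_locally_constant[OF s, of \<delta>] by blast
  show "is_lub K (trim \<delta> s) (trim \<delta> ` E)"
  proof (rule least_UpperI)
    show "x \<sqsubseteq>\<^bsub>K\<^esub> trim \<delta> s" if "x \<in> trim \<delta> ` E" for x
      using that le EK s by (auto intro: trim_mono[OF _ _ assms])
    fix y assume y: "y \<in> Upper K (trim \<delta> ` E)"
    show "trim \<delta> s \<sqsubseteq>\<^bsub>K\<^esub> y"
      unfolding le_iff
    proof
      fix U assume U: "U \<in> \<U>"
      define W where "W = light_part \<delta> s"
      let ?m = "real (card (top_layer W \<inter> U))"
      have WU: "W \<in> \<U>" using light_part_upper[OF s assms] by (simp add: W_def)
      have "trim \<delta> s U \<le> y U + \<epsilon>" if "\<epsilon> > 0" for \<epsilon>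
      proof -
        \<comment> \<open>The first bound fixes the light part. The second absorbs the error:
          \<open>\<eta>\<close> from \<open>U \<union> W\<close> and \<open>?m * \<eta>\<close> from
          the top layer.\<close>
        define \<eta> where "\<eta> = min \<eta>\<^sub>0 (\<epsilon> / (?m + 1))"
        have "\<eta> > 0" using \<eta>\<^sub>0 \<open>\<epsilon> > 0\<close> by (simp add: \<eta>_def)
        then obtain e where e: "e \<in> E" "\<forall>U\<in>\<U>. s U - \<eta> < e U"
          using directed_approx[OF dir lub] by blast
        have "\<forall>U\<in>\<U>. s U - \<eta>\<^sub>0 < e U"
          using e(2) by (fastforce simp: \<eta>_def)
        then have "light_part \<delta> e = W"
          using \<eta>\<^sub>0(2)[OF le[OF e(1)]] by (simp add: W_def)
        then have "trim \<delta> s U - trim \<delta> e U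
            = (s (U \<union> W) - e (U \<union> W)) - (s W - e W) + ?m * (s W - e W)"
          using U by (simp add: trim_def trim_at_def W_def algebra_simps)
        also have "\<dots> \<le> \<eta> - 0 + ?m * \<eta>"
        proof (intro add_mono diff_mono mult_left_mono)
          show "s (U \<union> W) - e (U \<union> W) \<le> \<eta>" "s W - e W \<le> \<eta>"
            using e(2) WU upper_set_Un[OF U WU] by (auto simp: algebra_simps less_imp_le)
          show "0 \<le> s W - e W" using le[OF e(1)] WU by (simp add: le_iff)
        qed simp
        also have "\<dots> = \<eta> * (?m + 1)" by (simp add: algebra_simps)
        also have "\<dots> \<le> \<epsilon> / (?m + 1) * (?m + 1)"
          by (intro mult_right_mono) (auto simp: \<eta>_def)
        also have "\<dots> = \<epsilon>" by (simp add: add_nonneg_eq_0_iff)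
        finally have "trim \<delta> s U - trim \<delta> e U \<le> \<epsilon>" .
        moreover have "trim \<delta> e \<sqsubseteq>\<^bsub>K\<^esub> y"
          using y e(1) EK trim_closed[OF _ assms] by (auto simp: Upper_def)
        ultimately show ?thesis using U by (auto simp: le_iff)
      qed
      then show "trim \<delta> s U \<le> y U" by (rule field_le_epsilon)
    qed
  qed (use EK s trim_closed[OF _ assms] in auto)
qed

lemma scott_continuous_compose:
  assumes f: "scott_continuous K K f" and g: "scott_continuous K K g"
  shows "scott_continuous K K (\<lambda>x. f (g x))"
proof -
  have f': "f \<in> carrier K \<rightarrow> carrier K" "isotone K K f"
      "\<And>E s. directed_in K E \<Longrightarrow> is_lub K s E \<Longrightarrow> is_lub K (f s) (f ` E)"
    and g': "g \<in> carrier K \<rightarrow> carrier K" "isotone K K g"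
      "\<And>E s. directed_in K E \<Longrightarrow> is_lub K s E \<Longrightarrow> is_lub K (g s) (g ` E)"
    using f g by (simp_all only: scott_continuous_def)
  have dir: "directed_in K (g ` E)" if E: "directed_in K E" for E
    unfolding directed_in_def
  proof (intro conjI ballI)
    have EK: "E \<subseteq> carrier K" and ne: "E \<noteq> {}"
      and Edir: "\<And>a b. a \<in> E \<Longrightarrow> b \<in> E \<Longrightarrow> \<exists>c\<in>E. a \<sqsubseteq>\<^bsub>K\<^esub> c \<and> b \<sqsubseteq>\<^bsub>K\<^esub> c"
      using E by (simp_all add: directed_in_def)
    show "g ` E \<subseteq> carrier K" using EK g'(1) by auto
    show "g ` E \<noteq> {}" using ne by simp
    fix x y assume "x \<in> g ` E" "y \<in> g ` E"
    then obtain a b where ab: "a \<in> E" "b \<in> E" "x = g a" "y = g b" by auto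
    then obtain c where c: "c \<in> E" "a \<sqsubseteq>\<^bsub>K\<^esub> c" "b \<sqsubseteq>\<^bsub>K\<^esub> c" using Edir by blast
    have "g a \<sqsubseteq>\<^bsub>K\<^esub> g c" "g b \<sqsubseteq>\<^bsub>K\<^esub> g c"
      using ab c EK by (auto intro!: use_iso1[OF g'(2)])
    then show "\<exists>z\<in>g ` E. x \<sqsubseteq>\<^bsub>K\<^esub> z \<and> y \<sqsubseteq>\<^bsub>K\<^esub> z" using ab c by blast
  qed
  show ?thesis
    unfolding scott_continuous_def
  proof (intro conjI allI impI)
    show "(\<lambda>x. f (g x)) \<in> carrier K \<rightarrow> carrier K" using f'(1) g'(1) by auto
    show "isotone K K (\<lambda>x. f (g x))"
      using iso_compose[OF g'(1,2) f'(1,2)] by (simp add: comp_def)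
    show "is_lub K (f (g s)) ((\<lambda>x. f (g x)) ` E)" if "directed_in K E \<and> is_lub K s E" for E s
      using f'(3)[OF dir g'(3)] that by (simp add: image_image)
  qed
qed

section \<open>Finite separation and the way-below relation\<close>

text \<open>Rounding all values down to multiples of \<open>\<delta>\<close> leaves finitely many
  patterns. Choosing one valuation for each pattern that occurs keeps the net inside the
  carrier.\<close>

lemma finite_net:
  assumes "\<delta> > 0"
  shows "\<exists>N. finite N \<and> N \<subseteq> carrier K \<and>
           (\<forall>x\<in>carrier K. \<exists>q\<in>N. \<forall>U\<in>\<U>. \<bar>q U - x U\<bar> < \<delta>)"
proof -
  define cell where "cell x = restrict (\<lambda>U. \<lfloor>x U / \<delta>\<rfloor>) \<U>" for x :: "'a set \<Rightarrow> real"
  have "cell x \<in> \<U> \<rightarrow>\<^sub>E {0..\<lfloor>1 / \<delta>\<rfloor>}" if "x \<in> carrier K" for x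
    using val_nonneg[OF that] val_le_one[OF that] assms
    by (auto simp: cell_def intro!: floor_mono divide_right_mono)
  then have "cell ` carrier K \<subseteq> \<U> \<rightarrow>\<^sub>E {0..\<lfloor>1 / \<delta>\<rfloor>}" by auto
  then have fin: "finite (cell ` carrier K)"
    by (rule finite_subset) (intro finite_PiE finite_upper_sets, simp)
  obtain N where N: "N \<subseteq> carrier K" "finite N" "cell ` carrier K = cell ` N"
    using finite_subset_image[OF fin order_refl] by metis
  have "\<exists>q\<in>N. \<forall>U\<in>\<U>. \<bar>q U - x U\<bar> < \<delta>" if "x \<in> carrier K" for x
  proof -
    have "cell x \<in> cell ` N" using N(3) that by (metis imageI)
    then obtain q where q: "q \<in> N" "cell x = cell q" by auto
    have "\<bar>q U - x U\<bar> < \<delta>" if "U \<in> \<U>" for U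
    proof -
      have "\<lfloor>x U / \<delta>\<rfloor> = \<lfloor>q U / \<delta>\<rfloor>"
        using fun_cong[OF q(2), of U] that by (simp add: cell_def)
      then have "\<bar>q U / \<delta> - x U / \<delta>\<bar> < 1" by linarith
      then have "\<bar>q U - x U\<bar> / \<delta> < 1"
        using assms by (simp add: diff_divide_distrib[symmetric])
      then show ?thesis using assms by simp
    qed
    then show ?thesis using q by blast
  qed
  then show ?thesis using N by blast
qed

text \<open>Trimming \<open>q\<close> lowers each value by \<open>\<delta>\<close> or to zero, which
  makes up for \<open>q\<close> exceeding \<open>x\<close> by up to \<open>\<delta>\<close>.\<close>

lemma trim_le_near:
  assumes "\<delta> > 0" "q \<in> carrier K" "x \<in> carrier K" "\<And>U. U \<in> \<U> \<Longrightarrow> q U - \<delta> \<le> x U"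
  shows "trim \<delta> q \<sqsubseteq>\<^bsub>K\<^esub> x"
  unfolding le_iff
  using trim_le[OF assms(2,1)] val_nonneg[OF assms(3)] assms(4) by fastforce

text \<open>The margin \<open>\<delta>\<close> is split: one half covers the excess of
  \<open>q\<close> over \<open>x\<close>, the other the distance from the supremum to a member of
  \<open>E\<close>.\<close>

lemma way_below_trim:
  assumes "\<delta> > 0" "q \<in> carrier K" "x \<in> carrier K" "\<And>U. U \<in> \<U> \<Longrightarrow> q U - \<delta> / 2 \<le> x U"
  shows "way_below K (trim \<delta> q) x"
  unfolding way_below_def
proof (intro allI impI, elim conjE)
  fix E s assume E: "directed_in K E" "is_lub K s E" "x \<sqsubseteq>\<^bsub>K\<^esub> s"
  obtain e where e: "e \<in> E" "\<forall>U\<in>\<U>. s U - \<delta> / 2 < e U"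
    using directed_approx[OF E(1,2), of "\<delta> / 2"] assms(1) by auto
  have "q U - \<delta> \<le> e U" if "U \<in> \<U>" for U
    using assms(4)[OF that] e(2)[rule_format, OF that] E(3)[unfolded le_iff, rule_format, OF that]
    by linarith
  then have "trim \<delta> q \<sqsubseteq>\<^bsub>K\<^esub> e"
    using assms e E(1) by (intro trim_le_near) (auto simp: directed_in_def)
  then show "\<exists>e\<in>E. trim \<delta> q \<sqsubseteq>\<^bsub>K\<^esub> e" using e by blast
qed

text \<open>For a net point \<open>q\<close> near \<open>x\<close>, the first trimming brings
  \<open>x\<close> below \<open>q\<close>; the second, by monotonicity, brings the result below
  \<open>trim \<delta> q\<close>, which is way below \<open>x\<close>.\<close>

lemma trim_trim_separated:
  assumes "\<delta> > 0"
  shows "\<exists>M. finite M \<and> M \<subseteq> carrier K \<and>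
     (\<forall>x\<in>carrier K. \<exists>m\<in>M. trim \<delta> (trim \<delta> x) \<sqsubseteq>\<^bsub>K\<^esub> m \<and> way_below K m x)"
proof -
  obtain N where N: "finite N" "N \<subseteq> carrier K"
    and net: "\<And>x. x \<in> carrier K \<Longrightarrow> \<exists>q\<in>N. \<forall>U\<in>\<U>. \<bar>q U - x U\<bar> < \<delta> / 2"
    using finite_net[of "\<delta> / 2"] assms by auto
  have "\<exists>m\<in>trim \<delta> ` N. trim \<delta> (trim \<delta> x) \<sqsubseteq>\<^bsub>K\<^esub> m \<and> way_below K m x"
    if x: "x \<in> carrier K" for x
  proof -
    obtain q where q: "q \<in> N" and near: "\<And>U. U \<in> \<U> \<Longrightarrow> \<bar>q U - x U\<bar> < \<delta> / 2"
      using net[OF x] by blast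
    have qK: "q \<in> carrier K" using q N by auto
    have below: "x U - \<delta> \<le> q U" "q U - \<delta> / 2 \<le> x U" if "U \<in> \<U>" for U
      using near[OF that] assms by linarith+
    have "trim \<delta> x \<sqsubseteq>\<^bsub>K\<^esub> q"
      using below(1) by (rule trim_le_near[OF assms x qK])
    then have "trim \<delta> (trim \<delta> x) \<sqsubseteq>\<^bsub>K\<^esub> trim \<delta> q"
      by (intro trim_mono trim_closed x qK assms)
    moreover have "way_below K (trim \<delta> q) x"
      using below(2) by (rule way_below_trim[OF assms qK x])
    ultimately show ?thesis using q by blast
  qed
  then show ?thesis
    using N trim_closed[OF _ assms] by (intro exI[of _ "trim \<delta> ` N"]) auto
qed

section \<open>The approximating sequence of double trimmings\<close>

theorem countably_based_FS_domain: "countably_based K \<and> FS_domain K"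
proof -
  define \<delta> :: "nat \<Rightarrow> real" where "\<delta> n = 1 / real (Suc n)" for n
  define f where "f n p = trim (\<delta> n) (trim (\<delta> n) p)" for n p
  \<comment> \<open>Two trimmings each lose at most half of \<open>A * \<delta> n\<close>, by
    \<open>trim_ge\<close>.\<close>
  define A where "A = 2 * base ^ Suc (card (carrier P))"
  have pos: "\<delta> n > 0" for n by (simp add: \<delta>_def)
  have "A > 0"
    unfolding A_def using base_power_ge_1[of "Suc (card (carrier P))"] by linarith
  have small: "\<exists>n. A * \<delta> n \<le> \<epsilon>" if "\<epsilon> > 0" for \<epsilon>
  proof -
    obtain n where "inverse (real (Suc n)) < \<epsilon> / A"
      using reals_Archimedean[of "\<epsilon> / A"] \<open>\<epsilon> > 0\<close> \<open>A > 0\<close> by auto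
    then have "inverse (real (Suc n)) * A < \<epsilon>"
      using pos_less_divide_eq[OF \<open>A > 0\<close>] by blast
    then have "A * \<delta> n \<le> \<epsilon>"
      by (simp only: \<delta>_def inverse_eq_divide mult.commute less_imp_le)
    then show ?thesis ..
  qed
  have cl: "f n p \<in> carrier K" if "p \<in> carrier K" for n p
    unfolding f_def by (intro trim_closed pos that)
  have lower: "p U - A * \<delta> n \<le> f n p U" if p: "p \<in> carrier K" and U: "U \<in> \<U>" for p U n
    using trim_ge[OF p pos U, of n] trim_ge[OF trim_closed[OF p pos] pos U, of n n]
    by (simp add: f_def A_def algebra_simps)
  have upper: "f n p U \<le> max 0 (p U - \<delta> n)" if p: "p \<in> carrier K" and U: "U \<in> \<U>" for p U n
    using trim_le[OF p pos U, of n] trim_le[OF trim_closed[OF p pos] pos U, of n n] pos[of n]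
    by (simp add: f_def)
  \<comment> \<open>Where \<open>f n p\<close> is positive it has lost at least
    \<open>\<delta> n\<close>, while \<open>f k p\<close> loses at most
    \<open>A * \<delta> k\<close>. So a sufficiently late index dominates any two given ones, which
    gives directedness.\<close>
  have dominate: "f n p \<sqsubseteq>\<^bsub>K\<^esub> f k p" if "A * \<delta> k \<le> \<delta> n" and p: "p \<in> carrier K" for n k p
    unfolding le_iff
  proof
    fix U assume U: "U \<in> \<U>"
    show "f n p U \<le> f k p U"
      using upper[OF p U, of n] lower[OF p U, of k] val_nonneg[OF cl[OF p] U, of k] that(1)
      by linarith
  qed
  have separated: "\<exists>M. finite M \<and> M \<subseteq> carrier K \<and>
      (\<forall>x\<in>carrier K. \<exists>m\<in>M. f n x \<sqsubseteq>\<^bsub>K\<^esub> m \<and> way_below K m x)" for n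
    using trim_trim_separated[OF pos[of n]] unfolding f_def .
  show ?thesis
  proof (rule countably_based_FS_domainI[of K f])
    show "dcpo K" by (rule dcpo_K)
    show "scott_continuous K K (f n)" for n
      unfolding f_def[abs_def]
      by (rule scott_continuous_compose[OF scott_continuous_trim[OF pos] scott_continuous_trim[OF pos]])
    show "\<exists>k. \<forall>x\<in>carrier K. f m x \<sqsubseteq>\<^bsub>K\<^esub> f k x \<and> f n x \<sqsubseteq>\<^bsub>K\<^esub> f k x" for m n
    proof -
      obtain k where "A * \<delta> k \<le> min (\<delta> m) (\<delta> n)"
        using small[of "min (\<delta> m) (\<delta> n)"] pos by auto
      then show ?thesis using dominate by (intro exI[of _ k]) auto
    qed
    show "\<exists>M. finite M \<and> M \<subseteq> carrier K \<and>
        (\<forall>x\<in>carrier K. \<exists>m\<in>M. f n x \<sqsubseteq>\<^bsub>K\<^esub> m \<and> way_below K m x)" for n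
      by (rule separated)
    fix x assume x: "x \<in> carrier K"
    show "is_lub K x (range (\<lambda>n. f n x))"
    proof (rule least_UpperI)
      show "y \<sqsubseteq>\<^bsub>K\<^esub> x" if y: "y \<in> range (\<lambda>n. f n x)" for y
        unfolding le_iff
      proof
        fix U assume U: "U \<in> \<U>"
        obtain n where "y = f n x" using y by auto
        then show "y U \<le> x U"
          using upper[OF x U, of n] pos[of n] val_nonneg[OF x U] by simp
      qed
      fix y assume y: "y \<in> Upper K (range (\<lambda>n. f n x))"
      show "x \<sqsubseteq>\<^bsub>K\<^esub> y"
        unfolding le_iff
      proof
        fix U assume U: "U \<in> \<U>"
        have "x U \<le> y U + \<epsilon>" if "\<epsilon> > 0" for \<epsilon>
        proof -
          obtain n where n: "A * \<delta> n \<le> \<epsilon>" using small \<open>\<epsilon> > 0\<close> by blast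
          have "f n x \<sqsubseteq>\<^bsub>K\<^esub> y" using y cl[OF x] by (auto simp: Upper_def)
          then show ?thesis using lower[OF x U, of n] n U by (auto simp: le_iff)
        qed
        then show "x U \<le> y U" by (rule field_le_epsilon)
      qed
    qed (use x cl in auto)
  qed
qed

end

theorem theorem3p14:
  fixes P :: "('a, 'b) gorder_scheme"
  assumes "partial_order P" and "finite (carrier P)"
  shows "countably_based (subprob_powerdomain P) \<and> FS_domain (subprob_powerdomain P)"
proof -
  interpret finite_poset P
    using assms by (simp add: finite_poset_def finite_poset_axioms_def)
  show ?thesis by (rule countably_based_FS_domain)
qed

end
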